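(* For $b<2$ let $f_b:[0,1]\to\mathbb{R}$, $f_b(x):=\frac{1}{1-bx+x^2}$, and let $\beta^{+}:=\frac{3+\sqrt{13}}{4}$. Then (1) $L_n(f_b)$ is monotonically decreasing in $n$ for all $b\in\big(-\infty,\tfrac12\big]$ and monotonically increasing in $n$ for all $b\in[1,\beta^+]$; (2) $R_n(f_b)$ is monotonically increasing in $n$ for all $b\in(-\infty,1]$ and monotonically decreasing in $n$ for all $b\in\big[\tfrac32,\beta^+\big]$.
   Context: For $f:[0,1]\to\mathbb{R}$ and an integer $n\ge 1$, the left and right Riemann sums of $f$ are $L_n(f):=\frac1n\sum_{k=0}^{n-1}f\big(\tfrac kn\big)$ and $R_n(f):=\frac1n\sum_{k=1}^{n}f\big(\tfrac kn\big)$. "Increasing" and "decreasing" (in $n$) are meant in the weak (non-strict) sense, over integers $n\geq 1$. *)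

theory Defs
  imports Complex_Main
begin

text \<open>Functions on the unit interval are represented by total functions on the reals.
  For \<open>n \<ge> 1\<close>, the sums below evaluate them only at points of \<open>{0..1}\<close>; the value at
  \<open>n = 0\<close> is irrelevant.\<close>

definition left_riemann :: "(real \<Rightarrow> real) \<Rightarrow> nat \<Rightarrow> real" where
  "left_riemann f n = 1 / real n * (\<Sum>k = 0..<n. f (real k / real n))"

definition right_riemann :: "(real \<Rightarrow> real) \<Rightarrow> nat \<Rightarrow> real" where
  "right_riemann f n = 1 / real n * (\<Sum>k = 1..n. f (real k / real n))"

text \<open>For \<open>b < 2\<close> the denominator is positive on \<open>{0..1}\<close>, so that no division by zero
  occurs there.\<close>

definition f_fam :: "real \<Rightarrow> real \<Rightarrow> real" where
  "f_fam b x = 1 / (1 - b * x + x ^ 2)"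

definition beta_plus :: real where
  "beta_plus = (3 + sqrt 13) / 4"

end

theory Submission
  imports Defs "HOL-Analysis.Convex"
begin

text \<open>
  Write \<open>L n\<close> and \<open>R n\<close> for the left and right Riemann sums of \<open>f_fam b\<close> and
  \<open>T n = (L n + R n) / 2\<close> for the trapezoidal sum. Since \<open>L n\<close> and \<open>R n\<close> differ from \<open>T n\<close>
  by \<open>\<plusminus> (f 0 - f 1) / (2 n)\<close>, with \<open>(f 0 - f 1) / 2 = d = (1 - b) / (2 (2 - b))\<close>, the
  Euler-Maclaurin expansion of \<open>T n\<close>
  (\<open>riemann_mean_expansion\<close>) gives, for \<open>\<bar>b\<bar> < 2\<close>,
  \<open>L n = I + d / n - c / n\<^sup>2 + O(1 / n ^ 4)\<close> and \<open>R n = I - d / n - c / n\<^sup>2 + O(1 / n ^ 4)\<close>,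
  where \<open>I\<close> is the integral and \<open>12 c = (1 + 2 b - b\<^sup>2) / (2 - b) = f' 0 - f' 1\<close>. The constant in
  the remainder is explicit because the fourth derivative of \<open>f_fam b\<close> is largest in modulus at
  the peak \<open>b / 2\<close> (\<open>f_fam4_bound\<close>).

  Such an expansion decides monotonicity in \<open>n\<close> as soon as the term in \<open>d\<close> has the right sign and
  is not outweighed by the other two at \<open>n = 2\<close>; relative to it they shrink as \<open>n\<close> grows
  (\<open>decreasing_of_expansion\<close>). For each of the four claims this condition is an elementary
  inequality in \<open>b\<close>, valid on all of the stated range with \<open>b > -1\<close>. The step from \<open>n = 1\<close> to
  \<open>n = 2\<close> leaves no room for an estimate and is computed exactly: there the bounds \<open>1/2\<close> and
  \<open>3/2\<close> on \<open>b\<close> appear as the cases of equality, whereas the bound \<open>1\<close> is where \<open>d\<close> vanishes.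

  For \<open>b \<le> -1\<close> the function \<open>f_fam b\<close> is convex and decreasing on the unit interval. Then the
  monotonicity is classical: each node \<open>k / n\<close> is a convex combination of two
  neighbouring nodes \<open>j / (n + 1)\<close>, and vice versa.
\<close>

section \<open>Riemann sums of convex decreasing functions\<close>

text \<open>The node \<open>k / (n + 1)\<close> is the convex combination of \<open>k / n\<close> and \<open>(k - 1) / n\<close> with weights
  \<open>(n + 1 - k) / (n + 1)\<close> and \<open>k / (n + 1)\<close>. Summed over \<open>k\<close>, each node \<open>j / n\<close> with \<open>j < n\<close> collects
  the weight \<open>(n + 2) / (n + 1)\<close>, and the endpoint \<open>1\<close> collects \<open>1 / (n + 1)\<close>. As \<open>f 1\<close> is the
  minimum, that last share can be replaced by the average over the other nodes.\<close>

lemma left_riemann_Suc_le_of_convex: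
  fixes f :: "real \<Rightarrow> real"
  assumes cvx: "convex_on {0..1} f"
    and dec: "\<And>x. x \<in> {0..1} \<Longrightarrow> f 1 \<le> f x"
    and n: "n \<ge> 1"
  shows "left_riemann f (Suc n) \<le> left_riemann f n"
proof -
  define G where "G = (\<lambda>j::nat. f (real j / real n))"
  define S where "S = (\<Sum>j<n. G j)"
  have n0: "real n > 0" using n by simp
  have pw: "f (real k / real (Suc n))
      \<le> (real n + 1 - real k) / (real n + 1) * G k + real k / (real n + 1) * G (k - 1)"
    if k: "k \<le> n" for k
  proof (cases k)
    case 0
    then show ?thesis by (simp add: G_def)
  next
    case (Suc m)
    define t where "t = real k / (real n + 1)"
    have "f ((1 - t) *\<^sub>R (real k / real n) + t *\<^sub>R (real m / real n))
        \<le> (1 - t) * f (real k / real n) + t * f (real m / real n)"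
      by (rule convex_onD[OF cvx]) (use k Suc n0 in \<open>auto simp: t_def field_simps\<close>)
    moreover have "(1 - t) *\<^sub>R (real k / real n) + t *\<^sub>R (real m / real n)
        = real k / real (Suc n)"
      using n0 by (simp add: t_def Suc divide_simps) (simp add: algebra_simps)
    moreover have "1 - t = (real n + 1 - real k) / (real n + 1)"
      using n0 by (simp add: t_def field_simps)
    ultimately show ?thesis by (simp add: G_def t_def Suc)
  qed
  have regroup: "(\<Sum>k<Suc m. (real n + 1 - real k) / (real n + 1) * G k
        + real k / (real n + 1) * G (k - 1))
      = (real n + 2) / (real n + 1) * (\<Sum>j<m. G j)
        + (real n + 1 - real m) / (real n + 1) * G m" for m
  proof (induction m)
    case (Suc m)
    then show ?case using n0 by (simp add: divide_simps) (simp add: algebra_simps)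
  qed (use n0 in simp)
  have "(\<Sum>k<Suc n. f (real k / real (Suc n)))
      \<le> (\<Sum>k<Suc n. (real n + 1 - real k) / (real n + 1) * G k
        + real k / (real n + 1) * G (k - 1))"
    by (rule sum_mono) (use pw in auto)
  also have "\<dots> = ((real n + 2) * S + G n) / (real n + 1)"
    unfolding regroup S_def by (simp add: add_divide_distrib distrib_right)
  also have "\<dots> \<le> (real n + 1) * S / real n"
  proof -
    have "(\<Sum>j<n. G n) \<le> S"
      unfolding S_def G_def using dec n0 by (intro sum_mono) (simp add: field_simps)
    then have "real n * G n \<le> S" by simp
    then show ?thesis using n0 by (simp add: divide_simps) (simp add: algebra_simps)
  qed
  finally show ?thesis
    using n0 unfolding left_riemann_def S_def G_def
    by (simp add: divide_simps atLeast0LessThan) (simp add: algebra_simps)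
qed

text \<open>Here the coarse node \<open>k / n\<close> is the convex combination of \<open>k / (n + 1)\<close> and \<open>(k + 1) / (n + 1)\<close>
  with weights \<open>1 - k / n\<close> and \<open>k / n\<close>. The inner fine nodes collect the weight \<open>(n - 1) / n\<close> and the
  endpoint collects \<open>1\<close>; moving the excess weight of the endpoint, where \<open>f\<close> is minimal, to the
  inner nodes increases the sum.\<close>

lemma right_riemann_le_Suc_of_convex:
  fixes f :: "real \<Rightarrow> real"
  assumes cvx: "convex_on {0..1} f"
    and dec: "\<And>x. x \<in> {0..1} \<Longrightarrow> f 1 \<le> f x"
    and n: "n \<ge> 1"
  shows "right_riemann f n \<le> right_riemann f (Suc n)"
proof -
  define F where "F = (\<lambda>j::nat. f (real j / real (Suc n)))"
  define S where "S = (\<Sum>j=1..n. F j)"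
  have n0: "real n > 0" using n by simp
  have pw: "f (real k / real n) \<le> (1 - real k / real n) * F k + real k / real n * F (Suc k)"
    if k: "k \<in> {1..n}" for k
  proof -
    define t where "t = real k / real n"
    have "f ((1 - t) *\<^sub>R (real k / real (Suc n)) + t *\<^sub>R (real (Suc k) / real (Suc n)))
        \<le> (1 - t) * f (real k / real (Suc n)) + t * f (real (Suc k) / real (Suc n))"
      by (rule convex_onD[OF cvx]) (use k n0 in \<open>auto simp: t_def field_simps\<close>)
    moreover have "(1 - t) *\<^sub>R (real k / real (Suc n)) + t *\<^sub>R (real (Suc k) / real (Suc n))
        = real k / real n"
      using n0 by (simp add: t_def divide_simps) (simp add: algebra_simps)
    ultimately show ?thesis by (simp add: F_def t_def)
  qed
  have regroup: "(\<Sum>k=1..m. (1 - real k / real n) * F k + real k / real n * F (Suc k))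
      = (real n - 1) / real n * (\<Sum>j=1..m. F j) + real m / real n * F (Suc m)" for m
  proof (induction m)
    case (Suc m)
    then show ?case using n0 by (simp add: divide_simps) (simp add: algebra_simps)
  qed simp
  have "(\<Sum>k=1..n. f (real k / real n))
      \<le> (\<Sum>k=1..n. (1 - real k / real n) * F k + real k / real n * F (Suc k))"
    by (rule sum_mono) (use pw in auto)
  also have "\<dots> = (real n - 1) / real n * S + F (Suc n)"
    unfolding regroup S_def using n0 by simp
  also have "\<dots> \<le> real n * (S + F (Suc n)) / (real n + 1)"
  proof -
    have "(\<Sum>j=1..n. F (Suc n)) \<le> S"
      unfolding S_def F_def using dec n0 by (intro sum_mono) (simp add: field_simps)
    then have "real n * F (Suc n) \<le> S" by simp
    then show ?thesis using n0 by (simp add: divide_simps) (simp add: algebra_simps)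
  qed
  finally show ?thesis
    using n0 unfolding right_riemann_def S_def F_def
    by (simp add: divide_simps) (simp add: algebra_simps)
qed

section \<open>The corrected trapezoidal rule\<close>

lemma abs_le_of_deriv_abs_le:
  fixes p q p' q' :: "real \<Rightarrow> real"
  assumes p: "\<And>t. t \<in> {0..h} \<Longrightarrow> (p has_real_derivative p' t) (at t)"
    and q: "\<And>t. t \<in> {0..h} \<Longrightarrow> (q has_real_derivative q' t) (at t)"
    and le: "\<And>t. t \<in> {0..h} \<Longrightarrow> \<bar>p' t\<bar> \<le> q' t"
    and p0: "p 0 = 0" and q0: "q 0 = 0" and t: "t \<in> {0..h}"
  shows "\<bar>p t\<bar> \<le> q t"
proof -
  have "q 0 - p 0 \<le> q t - p t"
  proof (rule DERIV_nonneg_imp_nondecreasing[where f = "\<lambda>t. q t - p t"])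
    show "\<exists>y. ((\<lambda>t. q t - p t) has_real_derivative y) (at x) \<and> 0 \<le> y"
      if "0 \<le> x" "x \<le> t" for x
      using DERIV_diff[OF q p, of x] le[of x] that t by force
  qed (use t in auto)
  moreover have "q 0 + p 0 \<le> q t + p t"
  proof (rule DERIV_nonneg_imp_nondecreasing[where f = "\<lambda>t. q t + p t"])
    show "\<exists>y. ((\<lambda>t. q t + p t) has_real_derivative y) (at x) \<and> 0 \<le> y"
      if "0 \<le> x" "x \<le> t" for x
      using DERIV_add[OF q p, of x] le[of x] that t by force
  qed (use t in auto)
  ultimately show ?thesis using p0 q0 by linarith
qed

text \<open>The error, as a function \<open>p0\<close> of the step length \<open>t\<close>, vanishes at \<open>0\<close> together with its
  first two derivatives \<open>p1\<close> and \<open>p2\<close>, and all terms of its third derivative cancel except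
  \<open>- t\<^sup>2 * f4 (a + t) / 12\<close>. Integrating the bound \<open>K * t\<^sup>2 / 12\<close> three times yields the constant
  \<open>1/720\<close>.\<close>

lemma corrected_trapezoid_interval:
  fixes A f f1 f2 f3 f4 :: "real \<Rightarrow> real"
  assumes A: "\<And>x. x \<in> {a..a+h} \<Longrightarrow> (A has_real_derivative f x) (at x)"
    and f: "\<And>x. x \<in> {a..a+h} \<Longrightarrow> (f has_real_derivative f1 x) (at x)"
    and f1: "\<And>x. x \<in> {a..a+h} \<Longrightarrow> (f1 has_real_derivative f2 x) (at x)"
    and f2: "\<And>x. x \<in> {a..a+h} \<Longrightarrow> (f2 has_real_derivative f3 x) (at x)"
    and f3: "\<And>x. x \<in> {a..a+h} \<Longrightarrow> (f3 has_real_derivative f4 x) (at x)"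
    and K: "\<And>x. x \<in> {a..a+h} \<Longrightarrow> \<bar>f4 x\<bar> \<le> K"
    and h: "h \<ge> 0"
  shows "\<bar>h * (f a + f (a + h)) / 2 - (A (a + h) - A a) - h\<^sup>2 * (f1 (a + h) - f1 a) / 12\<bar>
         \<le> K * h ^ 5 / 720"
proof -
  have sh: "((\<lambda>t. u (a + t)) has_real_derivative u' (a + t)) (at t)"
    if "\<And>x. x \<in> {a..a+h} \<Longrightarrow> (u has_real_derivative u' x) (at x)" "t \<in> {0..h}"
    for u u' :: "real \<Rightarrow> real" and t
    using that(1)[of "a + t"] that(2) DERIV_shift[of u "u' (a + t)" t a] by (auto simp: add.commute)
  note sh' = sh[OF A] sh[OF f] sh[OF f1] sh[OF f2] sh[OF f3]
  define p0 where "p0 = (\<lambda>t. t * (f a + f (a + t)) / 2 - (A (a + t) - A a)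
      - t\<^sup>2 * (f1 (a + t) - f1 a) / 12)"
  define p1 where "p1 = (\<lambda>t. (f a - f (a + t)) / 2 + t * f1 (a + t) / 2
      - t * (f1 (a + t) - f1 a) / 6 - t\<^sup>2 * f2 (a + t) / 12)"
  define p2 where "p2 = (\<lambda>t. t * f2 (a + t) / 6 - (f1 (a + t) - f1 a) / 6 - t\<^sup>2 * f3 (a + t) / 12)"
  have d0: "(p0 has_real_derivative p1 t) (at t)" if "t \<in> {0..h}" for t
    unfolding p0_def p1_def
    by (rule sh' that derivative_eq_intros refl | simp)+ (simp add: field_simps power2_eq_square)
  have d1: "(p1 has_real_derivative p2 t) (at t)" if "t \<in> {0..h}" for t
    unfolding p1_def p2_def
    by (rule sh' that derivative_eq_intros refl | simp)+ (simp add: field_simps power2_eq_square)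
  have d2: "(p2 has_real_derivative (- t\<^sup>2 * f4 (a + t) / 12)) (at t)" if "t \<in> {0..h}" for t
    unfolding p2_def
    by (rule sh' that derivative_eq_intros refl | simp)+ (simp add: field_simps power2_eq_square)
  have b2: "\<bar>p2 t\<bar> \<le> K * t ^ 3 / 36" if "t \<in> {0..h}" for t
  proof (rule abs_le_of_deriv_abs_le[OF d2 _ _ _ _ that])
    show "((\<lambda>t. K * t ^ 3 / 36) has_real_derivative K * t\<^sup>2 / 12) (at t)" for t
      by (rule derivative_eq_intros refl | simp)+
    show "\<bar>- t\<^sup>2 * f4 (a + t) / 12\<bar> \<le> K * t\<^sup>2 / 12" if "t \<in> {0..h}" for t
      using mult_left_mono[OF K[of "a + t"], of "t\<^sup>2"] that by (simp add: abs_mult mult.commute)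
  qed (auto simp: p2_def)
  have b1: "\<bar>p1 t\<bar> \<le> K * t ^ 4 / 144" if "t \<in> {0..h}" for t
  proof (rule abs_le_of_deriv_abs_le[OF d1 _ b2 _ _ that])
    show "((\<lambda>t. K * t ^ 4 / 144) has_real_derivative K * t ^ 3 / 36) (at t)" for t
      by (rule derivative_eq_intros refl | simp)+
  qed (auto simp: p1_def)
  have "\<bar>p0 h\<bar> \<le> K * h ^ 5 / 720"
  proof (rule abs_le_of_deriv_abs_le[OF d0 _ b1])
    show "((\<lambda>t. K * t ^ 5 / 720) has_real_derivative K * t ^ 4 / 144) (at t)" for t
      by (rule derivative_eq_intros refl | simp)+
  qed (use h in \<open>auto simp: p0_def\<close>)
  then show ?thesis by (simp add: p0_def)
qed

lemma left_riemann_minus_right_riemann: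
  "left_riemann f n - right_riemann f n = (f 0 - f 1) / real n"
proof (cases "n = 0")
  case False
  have "(\<Sum>k = 0..<m. f (real k / real n)) - (\<Sum>k = 1..m. f (real k / real n))
      = f 0 - f (real m / real n)" for m
    by (induction m) auto
  from this[of n] False show ?thesis
    by (simp add: left_riemann_def right_riemann_def diff_divide_distrib[symmetric])
qed (simp add: left_riemann_def right_riemann_def)

text \<open>Summing the interval estimates makes the corrections \<open>h\<^sup>2 * (f1 (x (k + 1)) - f1 (x k)) / 12\<close> and
  the increments of \<open>A\<close> telescope; \<open>n\<close> errors of size \<open>h ^ 5\<close> with \<open>h = 1 / n\<close> add up to \<open>h ^ 4\<close>.\<close>

lemma riemann_mean_expansion:
  fixes A f f1 f2 f3 f4 :: "real \<Rightarrow> real"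
  assumes A: "\<And>x. x \<in> {0..1} \<Longrightarrow> (A has_real_derivative f x) (at x)"
    and f: "\<And>x. x \<in> {0..1} \<Longrightarrow> (f has_real_derivative f1 x) (at x)"
    and f1: "\<And>x. x \<in> {0..1} \<Longrightarrow> (f1 has_real_derivative f2 x) (at x)"
    and f2: "\<And>x. x \<in> {0..1} \<Longrightarrow> (f2 has_real_derivative f3 x) (at x)"
    and f3: "\<And>x. x \<in> {0..1} \<Longrightarrow> (f3 has_real_derivative f4 x) (at x)"
    and K: "\<And>x. x \<in> {0..1} \<Longrightarrow> \<bar>f4 x\<bar> \<le> K"
    and n: "n \<ge> 1"
  shows "\<bar>(left_riemann f n + right_riemann f n) / 2 - (A 1 - A 0)
           - (f1 1 - f1 0) / (12 * real n ^ 2)\<bar> \<le> K / (720 * real n ^ 4)"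
proof -
  define h where "h = 1 / real n"
  define x where "x = (\<lambda>k::nat. real k / real n)"
  define e where "e = (\<lambda>k. h * (f (x k) + f (x (Suc k))) / 2 - (A (x (Suc k)) - A (x k))
      - h\<^sup>2 * (f1 (x (Suc k)) - f1 (x k)) / 12)"
  have n0: "real n > 0" using n by simp
  have e: "\<bar>e k\<bar> \<le> K * h ^ 5 / 720" if "k < n" for k
  proof -
    have x': "x (Suc k) = x k + h" by (simp add: x_def h_def add_divide_distrib)
    have sub: "y \<in> {0..1}" if "y \<in> {x k..x k + h}" for y
    proof -
      have "x (Suc k) \<le> 1" using \<open>k < n\<close> by (simp add: x_def)
      moreover have "0 \<le> x k" by (simp add: x_def)
      ultimately show ?thesis using that x' by auto
    qed
    have "h \<ge> 0" by (simp add: h_def)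
    from corrected_trapezoid_interval[OF A[OF sub] f[OF sub] f1[OF sub] f2[OF sub] f3[OF sub]
        K[OF sub] this]
    show ?thesis by (simp add: e_def x')
  qed
  have tele: "(\<Sum>k<m. e k) = h * ((\<Sum>k=0..<m. f (x k)) + (\<Sum>k=1..m. f (x k))) / 2
      - (A (x m) - A 0) - h\<^sup>2 * (f1 (x m) - f1 0) / 12" for m
    by (induction m) (auto simp: e_def field_simps x_def)
  have "\<bar>\<Sum>k<n. e k\<bar> \<le> (\<Sum>k<n. K * h ^ 5 / 720)"
    by (rule order_trans[OF sum_abs sum_mono]) (use e in auto)
  also have "\<dots> = K / (720 * real n ^ 4)"
    using n0 by (simp add: h_def divide_simps) (simp add: eval_nat_numeral)
  also have "(\<Sum>k<n. e k) = (left_riemann f n + right_riemann f n) / 2 - (A 1 - A 0)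
           - (f1 1 - f1 0) / (12 * real n ^ 2)"
    unfolding tele using n0
    by (simp add: left_riemann_def right_riemann_def x_def h_def field_simps power2_eq_square)
  finally show ?thesis .
qed

section \<open>Monotonicity from an asymptotic expansion\<close>

text \<open>After multiplication by \<open>n * (n + 1)\<close>, the difference \<open>X n - X (n + 1)\<close> is at least
  \<open>d - t * c - M * n * (n + 1) * (1 / n ^ 4 + 1 / (n + 1) ^ 4)\<close> with
  \<open>t = (2 * n + 1) / (n * (n + 1))\<close>. For \<open>n \<ge> 2\<close> one has \<open>0 \<le> t \<le> 5/6\<close>, and the factor of \<open>M\<close>
  is at most \<open>27/50 * t\<close> (at \<open>n = 2\<close> it is \<open>97/180 * t\<close>). The resulting lower bound
  \<open>d - t * (c + 27/50 * M)\<close> is affine in \<open>t\<close>; the two assumptions on \<open>d\<close> say that it is nonnegative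
  at both ends of \<open>{0..5/6}\<close>.\<close>

lemma decreasing_of_expansion:
  fixes X :: "nat \<Rightarrow> real"
  assumes X: "\<And>n. n \<ge> 1 \<Longrightarrow> \<bar>X n - (I + d / real n - c / real n ^ 2)\<bar> \<le> M / real n ^ 4"
    and d: "d \<ge> 0" "d \<ge> 5/6 * (c + 27/50 * M)"
    and n: "n \<ge> 2"
  shows "X (Suc n) \<le> X n"
proof -
  define r where "r = real n"
  define t where "t = (2 * r + 1) / (r * (r + 1))"
  have r: "r \<ge> 2" using n by (simp add: r_def)
  then have pos: "r > 0" "r + 1 > 0" "r * (r + 1) > 0" by auto
  have M: "M \<ge> 0" using X[of 1] by auto
  have t: "0 \<le> t" "t \<le> 5/6"
  proof -
    show "0 \<le> t" using r by (simp add: t_def)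
    have "0 \<le> (r - 2) * (5 * r + 3)" using r by simp
    then show "t \<le> 5/6" using pos by (simp add: t_def divide_simps) (simp add: algebra_simps)
  qed
  have rest: "r * (r + 1) * (1 / r ^ 4 + 1 / (r + 1) ^ 4) \<le> 27/50 * t"
  proof -
    \<comment> \<open>In powers of \<open>r - 2\<close>, the difference of the two sides has only nonnegative coefficients.\<close>
    define s where "s = r - 2"
    have s: "s \<ge> 0" "r = s + 2" using r by (auto simp: s_def)
    have "50 * ((r + 1) ^ 4 + r ^ 4) \<le> 27 * (2 * r + 1) * (r\<^sup>2 * (r + 1)\<^sup>2)"
      unfolding s(2) using s(1)
      by (simp add: eval_nat_numeral algebra_simps add_nonneg_nonneg mult_nonneg_nonneg)
    moreover have "r * (r + 1) * (1 / r ^ 4 + 1 / (r + 1) ^ 4)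
        = ((r + 1) ^ 4 + r ^ 4) / (r ^ 3 * (r + 1) ^ 3)"
      using pos by (simp add: divide_simps) (simp add: eval_nat_numeral algebra_simps)
    moreover have "27/50 * t
        = 27/50 * ((2 * r + 1) * (r\<^sup>2 * (r + 1)\<^sup>2)) / (r ^ 3 * (r + 1) ^ 3)"
      using pos by (simp add: t_def divide_simps) (simp add: eval_nat_numeral algebra_simps)
    moreover have "((r + 1) ^ 4 + r ^ 4) / (r ^ 3 * (r + 1) ^ 3)
        \<le> 27/50 * ((2 * r + 1) * (r\<^sup>2 * (r + 1)\<^sup>2)) / (r ^ 3 * (r + 1) ^ 3)"
    proof (rule divide_right_mono)
      have "p \<le> 27/50 * q" if "50 * p \<le> 27 * q" for p q :: real using that by linarith
      from this[OF calculation(1)[unfolded mult.assoc]]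
      show "(r + 1) ^ 4 + r ^ 4 \<le> 27/50 * ((2 * r + 1) * (r\<^sup>2 * (r + 1)\<^sup>2))" .
    qed (use pos in simp)
    ultimately show ?thesis by linarith
  qed
  have lin: "d - t * (c + 27/50 * M) \<ge> 0"
  proof (cases "c + 27/50 * M \<ge> 0")
    case True
    then show ?thesis using mult_right_mono[OF t(2) True] d(2) by linarith
  next
    case False
    then show ?thesis using d(1) t(1) mult_nonneg_nonpos[of t "c + 27/50 * M"] by linarith
  qed
  have "X n \<ge> I + d / r - c / r ^ 2 - M / r ^ 4"
    using X[of n] n by (simp add: r_def abs_le_iff)
  moreover have "X (Suc n) \<le> I + d / (r + 1) - c / (r + 1) ^ 2 + M / (r + 1) ^ 4"
    using X[of "Suc n"] n by (simp add: r_def abs_le_iff add.commute)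
  moreover have "0 \<le> (d / r - c / r ^ 2 - M / r ^ 4)
      - (d / (r + 1) - c / (r + 1) ^ 2 + M / (r + 1) ^ 4)"
  proof -
    have a: "r * (r + 1) * (d / r - d / (r + 1)) = d"
      using pos by (simp add: divide_simps) (simp add: algebra_simps)
    have b: "r * (r + 1) * (c / r ^ 2 - c / (r + 1) ^ 2) = t * c"
      using pos by (simp add: t_def divide_simps) (simp add: eval_nat_numeral algebra_simps)
    have "r * (r + 1) * ((d / r - c / r ^ 2 - M / r ^ 4)
        - (d / (r + 1) - c / (r + 1) ^ 2 + M / (r + 1) ^ 4))
      = r * (r + 1) * (d / r - d / (r + 1)) - r * (r + 1) * (c / r ^ 2 - c / (r + 1) ^ 2)
        - M * (r * (r + 1) * (1 / r ^ 4 + 1 / (r + 1) ^ 4))"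
      by (simp add: algebra_simps)
    also have "\<dots> \<ge> d - t * c - M * (27/50 * t)"
      unfolding a b using mult_left_mono[OF rest M] by linarith
    finally have "r * (r + 1) * ((d / r - c / r ^ 2 - M / r ^ 4)
        - (d / (r + 1) - c / (r + 1) ^ 2 + M / (r + 1) ^ 4)) \<ge> 0"
      using lin by (simp add: algebra_simps)
    then show ?thesis using pos by (simp add: zero_le_mult_iff)
  qed
  ultimately show ?thesis by linarith
qed

section \<open>Derivatives of the family\<close>

lemma quotient_power_has_derivative:
  fixes u g :: "real \<Rightarrow> real"
  assumes u: "(u has_real_derivative u') (at x)" and g: "(g has_real_derivative g') (at x)"
    and g0: "g x \<noteq> 0"
  shows "((\<lambda>x. u x / g x ^ k) has_real_derivative
           (u' * g x - real k * u x * g') / g x ^ Suc k) (at x)"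
proof -
  have "((\<lambda>x. u x / g x ^ k) has_real_derivative
      (u' * g x ^ k - u x * (real k * g x ^ (k - 1) * g')) / (g x ^ k * g x ^ k)) (at x)"
    using g0 by (auto intro!: derivative_eq_intros u g)
  moreover have "(u' * g x ^ k - u x * (real k * g x ^ (k - 1) * g')) / (g x ^ k * g x ^ k)
      = (u' * g x - real k * u x * g') / g x ^ Suc k"
    using g0 by (cases k) (simp_all add: divide_simps, simp add: algebra_simps)
  ultimately show ?thesis by simp
qed

definition f_fam1 :: "real \<Rightarrow> real \<Rightarrow> real" where
  "f_fam1 b x = (b - 2 * x) / (1 - b * x + x\<^sup>2) ^ 2"

definition f_fam2 :: "real \<Rightarrow> real \<Rightarrow> real" where
  "f_fam2 b x = (6 * x\<^sup>2 - 6 * b * x + 2 * b\<^sup>2 - 2) / (1 - b * x + x\<^sup>2) ^ 3"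

definition f_fam3 :: "real \<Rightarrow> real \<Rightarrow> real" where
  "f_fam3 b x = 6 * (2 * x - b) * (2 - b\<^sup>2 + 2 * b * x - 2 * x\<^sup>2) / (1 - b * x + x\<^sup>2) ^ 4"

definition f_fam4 :: "real \<Rightarrow> real \<Rightarrow> real" where
  "f_fam4 b x = 24 * ((2 * x - b) ^ 4 - 3 * (2 * x - b)\<^sup>2 * (1 - b * x + x\<^sup>2)
     + (1 - b * x + x\<^sup>2)\<^sup>2) / (1 - b * x + x\<^sup>2) ^ 5"

lemma f_fam_derivs:
  assumes g0: "1 - b * x + x\<^sup>2 \<noteq> 0"
  shows "(f_fam b has_real_derivative f_fam1 b x) (at x)"
    and "(f_fam1 b has_real_derivative f_fam2 b x) (at x)"
    and "(f_fam2 b has_real_derivative f_fam3 b x) (at x)"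
    and "(f_fam3 b has_real_derivative f_fam4 b x) (at x)"
proof -
  have g: "((\<lambda>x. 1 - b * x + x\<^sup>2) has_real_derivative 2 * x - b) (at x)"
    by (auto intro!: derivative_eq_intros)
  note q = quotient_power_has_derivative[OF _ g g0]
  have "((\<lambda>x. 1) has_real_derivative 0) (at x)" by simp
  from q[OF this, of 1] show "(f_fam b has_real_derivative f_fam1 b x) (at x)"
    unfolding f_fam_def[abs_def] f_fam1_def by (simp add: power2_eq_square)
  have "((\<lambda>x. b - 2 * x) has_real_derivative - 2) (at x)"
    by (auto intro!: derivative_eq_intros)
  from q[OF this, of 2] show "(f_fam1 b has_real_derivative f_fam2 b x) (at x)"
    unfolding f_fam1_def[abs_def] f_fam2_def
    by (rule DERIV_cong) (rule arg_cong2[where f="(/)"], simp only: of_nat_numeral, algebra, simp)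
  have "((\<lambda>x. 6 * x\<^sup>2 - 6 * b * x + 2 * b\<^sup>2 - 2) has_real_derivative 12 * x - 6 * b) (at x)"
    by (auto intro!: derivative_eq_intros)
  from q[OF this, of 3] show "(f_fam2 b has_real_derivative f_fam3 b x) (at x)"
    unfolding f_fam2_def[abs_def] f_fam3_def
    by (rule DERIV_cong) (rule arg_cong2[where f="(/)"], simp only: of_nat_numeral, algebra, simp)
  have "((\<lambda>x. 6 * (2 * x - b) * (2 - b\<^sup>2 + 2 * b * x - 2 * x\<^sup>2)) has_real_derivative
      12 * (2 - b\<^sup>2 + 2 * b * x - 2 * x\<^sup>2) + 6 * (2 * x - b) * (2 * b - 4 * x)) (at x)"
    by (auto intro!: derivative_eq_intros)
  from q[OF this, of 4] show "(f_fam3 b has_real_derivative f_fam4 b x) (at x)"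
    unfolding f_fam3_def[abs_def] f_fam4_def
    by (rule DERIV_cong) (rule arg_cong2[where f="(/)"], simp only: of_nat_numeral, algebra, simp)
qed

lemma f_fam_discriminant_pos:
  fixes b :: real
  assumes "\<bar>b\<bar> < 2"
  shows "1 - b\<^sup>2 / 4 > 0"
  using power_strict_mono[of "\<bar>b\<bar>" 2 2] assms by simp

text \<open>With \<open>\<sigma> = 1 - b\<^sup>2 / 4\<close> and \<open>Y = (x - b / 2)\<^sup>2\<close> the fourth derivative equals
  \<open>24 * (5 * Y\<^sup>2 - 10 * \<sigma> * Y + \<sigma>\<^sup>2) / (\<sigma> + Y) ^ 5\<close>, which is \<open>24 / \<sigma> ^ 3\<close> at the peak \<open>Y = 0\<close>. That
  this is the largest modulus follows by expanding \<open>(\<sigma> + Y) ^ 5\<close>; in the lower bound the expansion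
  leaves \<open>- 5 * \<sigma> ^ 4 * Y\<close> from \<open>- 10 * \<sigma> ^ 4 * Y\<close>, and completing the square absorbs it.\<close>

lemma f_fam4_bound:
  assumes b: "\<bar>b\<bar> < 2"
  shows "\<bar>f_fam4 b x\<bar> \<le> 24 / (1 - b\<^sup>2 / 4) ^ 3"
proof -
  define \<sigma> where "\<sigma> = 1 - b\<^sup>2 / 4"
  define Y where "Y = (x - b / 2)\<^sup>2"
  have \<sigma>: "\<sigma> > 0" using f_fam_discriminant_pos[OF b] by (simp add: \<sigma>_def)
  have Y: "Y \<ge> 0" by (simp add: Y_def)
  have g: "1 - b * x + x\<^sup>2 = \<sigma> + Y"
    by (simp add: \<sigma>_def Y_def power2_eq_square field_simps)
  have u: "(2 * x - b)\<^sup>2 = 4 * Y"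
    by (simp add: Y_def power2_eq_square field_simps)
  have u4: "(2 * x - b) ^ 4 = 16 * Y\<^sup>2"
  proof -
    have "(2 * x - b) ^ 4 = ((2 * x - b)\<^sup>2)\<^sup>2" by simp
    then show ?thesis unfolding u by (simp add: power_mult_distrib)
  qed
  have f4: "f_fam4 b x = 24 * (5 * Y\<^sup>2 - 10 * \<sigma> * Y + \<sigma>\<^sup>2) / (\<sigma> + Y) ^ 5"
    unfolding f_fam4_def g u u4 by (simp add: power2_eq_square algebra_simps)
  have expand: "(\<sigma> + Y) ^ 5
      = \<sigma>^5 + 5 * (\<sigma>^4 * Y) + 10 * (\<sigma>^3 * Y^2) + 10 * (\<sigma>^2 * Y^3) + 5 * (\<sigma> * Y^4) + Y^5"
    by (simp add: eval_nat_numeral algebra_simps)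
  have nn: "0 \<le> \<sigma>^4 * Y" "0 \<le> \<sigma>^3 * Y^2" "0 \<le> \<sigma>^2 * Y^3" "0 \<le> \<sigma> * Y^4" "0 \<le> Y^5"
    using \<sigma> Y by auto
  have "0 \<le> \<sigma>^3 * (15 * (Y - \<sigma> / 6)\<^sup>2)" using \<sigma> by simp
  then have sq: "0 \<le> 15 * (\<sigma>^3 * Y^2) - 5 * (\<sigma>^4 * Y) + 5/12 * \<sigma>^5"
    by (simp add: eval_nat_numeral algebra_simps)
  have "\<bar>(5 * Y\<^sup>2 - 10 * \<sigma> * Y + \<sigma>\<^sup>2) * \<sigma>^3\<bar> \<le> (\<sigma> + Y) ^ 5"
  proof -
    have e: "(5 * Y\<^sup>2 - 10 * \<sigma> * Y + \<sigma>\<^sup>2) * \<sigma>^3 = 5 * (\<sigma>^3 * Y^2) - 10 * (\<sigma>^4 * Y) + \<sigma>^5"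
      by (simp add: eval_nat_numeral algebra_simps)
    have "0 < \<sigma>^5" using \<sigma> by simp
    then show ?thesis unfolding e expand abs_le_iff using nn sq by (intro conjI; linarith)
  qed
  then show ?thesis
    using \<sigma> Y
    by (simp add: f4 \<sigma>_def[symmetric] abs_mult pos_divide_le_eq pos_le_divide_eq mult.assoc
        del: distrib_left_numeral right_diff_distrib_numeral)
qed

lemma f_fam_antiderivative:
  assumes b: "\<bar>b\<bar> < 2"
  shows "\<exists>A. \<forall>x. (A has_real_derivative f_fam b x) (at x)"
proof -
  define s where "s = sqrt (1 - b\<^sup>2 / 4)"
  have s: "s > 0" "s\<^sup>2 = 1 - b\<^sup>2 / 4" using f_fam_discriminant_pos[OF b] by (simp_all add: s_def)
  have "((\<lambda>x. arctan ((x - b / 2) / s) / s) has_real_derivative f_fam b x) (at x)" for x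
  proof -
    have "((\<lambda>x. arctan ((x - b / 2) / s) / s) has_real_derivative
        inverse (1 + ((x - b / 2) / s)\<^sup>2) * (1 / s) / s) (at x)"
      using s(1) by (auto intro!: derivative_eq_intros)
    moreover have "inverse (1 + ((x - b / 2) / s)\<^sup>2) * (1 / s) / s = 1 / (s\<^sup>2 + (x - b / 2)\<^sup>2)"
    proof -
      have "s\<^sup>2 + (x - b / 2)\<^sup>2 > 0" using s(1) by (simp add: add_pos_nonneg)
      then show ?thesis using s(1)
        by (simp add: power_divide add_divide_eq_iff inverse_eq_divide power2_eq_square)
    qed
    moreover have "s\<^sup>2 + (x - b / 2)\<^sup>2 = 1 - b * x + x\<^sup>2"
      unfolding s(2) by (simp add: power2_eq_square field_simps)
    ultimately show ?thesis by (simp add: f_fam_def)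
  qed
  then show ?thesis by blast
qed

section \<open>Expansion of the Riemann sums of the family\<close>

lemma f_fam_riemann_expansion:
  assumes b: "\<bar>b\<bar> < 2"
  obtains I where
    "\<And>n. n \<ge> 1 \<Longrightarrow> \<bar>left_riemann (f_fam b) n
        - (I + (1 - b) / (2 * (2 - b)) / real n - (1 + 2 * b - b\<^sup>2) / (12 * (2 - b)) / real n ^ 2)\<bar>
      \<le> 1 / (30 * (1 - b\<^sup>2 / 4) ^ 3) / real n ^ 4"
    "\<And>n. n \<ge> 1 \<Longrightarrow> \<bar>right_riemann (f_fam b) n
        - (I - (1 - b) / (2 * (2 - b)) / real n - (1 + 2 * b - b\<^sup>2) / (12 * (2 - b)) / real n ^ 2)\<bar>
      \<le> 1 / (30 * (1 - b\<^sup>2 / 4) ^ 3) / real n ^ 4"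
proof -
  obtain A where A: "\<And>x. (A has_real_derivative f_fam b x) (at x)"
    using f_fam_antiderivative[OF b] by blast
  have b2: "2 - b > 0" using b by auto
  have g0: "1 - b * x + x\<^sup>2 \<noteq> 0" for x
  proof -
    have "1 - b * x + x\<^sup>2 = (1 - b\<^sup>2 / 4) + (x - b / 2)\<^sup>2"
      by (simp add: power2_eq_square field_simps)
    moreover have "(x - b / 2)\<^sup>2 \<ge> 0" by simp
    ultimately have "1 - b * x + x\<^sup>2 > 0" using f_fam_discriminant_pos[OF b] by linarith
    then show ?thesis by simp
  qed
  define d where "d = (1 - b) / (2 * (2 - b))"
  define c where "c = (1 + 2 * b - b\<^sup>2) / (12 * (2 - b))"
  define M where "M = 1 / (30 * (1 - b\<^sup>2 / 4) ^ 3)"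
  define T where "T = (\<lambda>n. (left_riemann (f_fam b) n + right_riemann (f_fam b) n) / 2)"
  have "f_fam1 b 1 - f_fam1 b 0 = - 12 * c"
    using b2 by (simp add: f_fam1_def c_def divide_simps) (simp add: power2_eq_square algebra_simps)
  then have T: "\<bar>T n - (A 1 - A 0 - c / real n ^ 2)\<bar> \<le> M / real n ^ 4" if "n \<ge> 1" for n
    using riemann_mean_expansion[OF A f_fam_derivs[OF g0] f_fam4_bound[OF b] that]
    by (simp add: T_def M_def mult.commute mult.left_commute diff_diff_eq2 add.commute
        diff_add_eq)
  have D: "(left_riemann (f_fam b) n - right_riemann (f_fam b) n) / 2 = d / real n" for n
  proof -
    have "(f_fam b 0 - f_fam b 1) / 2 = d"
      using b2 by (simp add: f_fam_def d_def divide_simps)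
    then show ?thesis unfolding left_riemann_minus_right_riemann by simp
  qed
  have offset: "left_riemann (f_fam b) n - (A 1 - A 0 + d / real n - c / real n ^ 2)
      = T n - (A 1 - A 0 - c / real n ^ 2)"
    and offset': "right_riemann (f_fam b) n - (A 1 - A 0 - d / real n - c / real n ^ 2)
      = T n - (A 1 - A 0 - c / real n ^ 2)" for n
    using D[of n] by (simp_all add: T_def field_simps)
  have "\<bar>left_riemann (f_fam b) n - (A 1 - A 0 + d / real n - c / real n ^ 2)\<bar> \<le> M / real n ^ 4"
    and "\<bar>right_riemann (f_fam b) n - (A 1 - A 0 - d / real n - c / real n ^ 2)\<bar> \<le> M / real n ^ 4"
    if "n \<ge> 1" for n
    unfolding offset offset' by (rule T[OF that])+
  then show thesis by (rule that[unfolded d_def[symmetric] c_def[symmetric] M_def[symmetric]])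
qed

text \<open>The signs \<open>e1\<close> and \<open>e2\<close> treat the four claims at once: \<open>e1 * e2\<close> is \<open>1\<close> for left and \<open>- 1\<close> for
  right sums, and \<open>e2 = - 1\<close> means that \<open>X\<close> is the negative of the Riemann sum. Multiplying the
  conditions of \<open>decreasing_of_expansion\<close> by \<open>2 - b\<close> clears the denominators of \<open>d\<close> and \<open>c\<close>, so that
  only an upper bound \<open>m\<close> for \<open>M * (2 - b)\<close> is needed.\<close>

lemma f_fam_step:
  fixes X :: "nat \<Rightarrow> real"
  assumes b: "b < 2"
    and d: "d = (1 - b) / (2 * (2 - b))" and c: "c = (1 + 2 * b - b\<^sup>2) / (12 * (2 - b))"
    and X: "\<And>n. n \<ge> 1 \<Longrightarrow> \<bar>X n - (I + (e1 * d) / real n - (e2 * c) / real n ^ 2)\<bar> \<le> M / real n ^ 4"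
    and M: "M * (2 - b) \<le> m"
    and sgn: "e1 * (1 - b) \<ge> 0"
    and crit: "5/72 * (e2 * (1 + 2 * b - b\<^sup>2)) + 9/20 * m \<le> e1 * (1 - b) / 2"
    and n: "n \<ge> 2"
  shows "X (Suc n) \<le> X n"
proof (rule decreasing_of_expansion[OF X _ _ n])
  show "0 \<le> e1 * d"
    using sgn b by (simp add: d zero_le_divide_iff)
  have "5/6 * (e2 * c + 27/50 * M)
      = (5/72 * (e2 * (1 + 2 * b - b\<^sup>2)) + 9/20 * (M * (2 - b))) / (2 - b)"
    using b by (simp add: c field_simps)
  also have "\<dots> \<le> (e1 * (1 - b) / 2) / (2 - b)"
    by (rule divide_right_mono) (use crit M b in linarith)+
  finally show "5/6 * (e2 * c + 27/50 * M) \<le> e1 * d" by (simp add: d)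
qed auto

lemma f_fam_monotone_steps:
  assumes b: "\<bar>b\<bar> < 2"
    and m: "1 / (30 * (1 - b\<^sup>2 / 4) ^ 3) * (2 - b) \<le> m"
    and n: "n \<ge> 2"
  shows "b \<le> 1 \<Longrightarrow> 5/72 * (1 + 2 * b - b\<^sup>2) + 9/20 * m \<le> (1 - b) / 2 \<Longrightarrow>
      left_riemann (f_fam b) (Suc n) \<le> left_riemann (f_fam b) n"
    and "b \<ge> 1 \<Longrightarrow> 9/20 * m \<le> (b - 1) / 2 + 5/72 * (1 + 2 * b - b\<^sup>2) \<Longrightarrow>
      left_riemann (f_fam b) n \<le> left_riemann (f_fam b) (Suc n)"
    and "b \<le> 1 \<Longrightarrow> 9/20 * m \<le> (1 - b) / 2 + 5/72 * (1 + 2 * b - b\<^sup>2) \<Longrightarrow>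
      right_riemann (f_fam b) n \<le> right_riemann (f_fam b) (Suc n)"
    and "b \<ge> 1 \<Longrightarrow> 5/72 * (1 + 2 * b - b\<^sup>2) + 9/20 * m \<le> (b - 1) / 2 \<Longrightarrow>
      right_riemann (f_fam b) (Suc n) \<le> right_riemann (f_fam b) n"
proof -
  have b2: "b < 2" using b by auto
  define d where "d = (1 - b) / (2 * (2 - b))"
  define c where "c = (1 + 2 * b - b\<^sup>2) / (12 * (2 - b))"
  define M where "M = 1 / (30 * (1 - b\<^sup>2 / 4) ^ 3)"
  obtain I where
    L: "\<And>n. n \<ge> 1 \<Longrightarrow> \<bar>left_riemann (f_fam b) n - (I + d / real n - c / real n ^ 2)\<bar> \<le> M / real n ^ 4" and
    R: "\<And>n. n \<ge> 1 \<Longrightarrow> \<bar>right_riemann (f_fam b) n - (I - d / real n - c / real n ^ 2)\<bar> \<le> M / real n ^ 4"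
    using f_fam_riemann_expansion[OF b] unfolding d_def c_def M_def by metis
  note step = f_fam_step[OF b2 d_def c_def _ m[folded M_def] _ _ n]
  have negate: "\<bar>- x - y\<bar> \<le> M" if "\<bar>x - z\<bar> \<le> M" "y = - z" for x y z M :: real
    using that by linarith
  show "left_riemann (f_fam b) (Suc n) \<le> left_riemann (f_fam b) n"
    if "b \<le> 1" "5/72 * (1 + 2 * b - b\<^sup>2) + 9/20 * m \<le> (1 - b) / 2"
  proof (rule step[where I = I and ?e1.0 = 1 and ?e2.0 = 1])
    show "\<bar>left_riemann (f_fam b) n - (I + 1 * d / real n - 1 * c / real n ^ 2)\<bar> \<le> M / real n ^ 4"
      if "n \<ge> 1" for n using L[OF that] by simp
  qed (use that in simp_all)
  show "right_riemann (f_fam b) (Suc n) \<le> right_riemann (f_fam b) n"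
    if "b \<ge> 1" "5/72 * (1 + 2 * b - b\<^sup>2) + 9/20 * m \<le> (b - 1) / 2"
  proof (rule step[where I = I and ?e1.0 = "-1" and ?e2.0 = 1])
    show "\<bar>right_riemann (f_fam b) n - (I + -1 * d / real n - 1 * c / real n ^ 2)\<bar> \<le> M / real n ^ 4"
      if "n \<ge> 1" for n using R[OF that] by simp
  qed (use that in simp_all)
  have "- left_riemann (f_fam b) (Suc n) \<le> - left_riemann (f_fam b) n"
    if "b \<ge> 1" "9/20 * m \<le> (b - 1) / 2 + 5/72 * (1 + 2 * b - b\<^sup>2)"
  proof (rule step[where I = "- I" and ?e1.0 = "-1" and ?e2.0 = "-1"])
    show "\<bar>- left_riemann (f_fam b) n - (- I + -1 * d / real n - -1 * c / real n ^ 2)\<bar> \<le> M / real n ^ 4"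
      if "n \<ge> 1" for n by (rule negate[OF L[OF that]]) simp
    show "5/72 * (-1 * (1 + 2 * b - b\<^sup>2)) + 9/20 * m \<le> -1 * (1 - b) / 2"
      using that by (simp add: field_simps)
  qed (use that in simp_all)
  then show "left_riemann (f_fam b) n \<le> left_riemann (f_fam b) (Suc n)"
    if "b \<ge> 1" "9/20 * m \<le> (b - 1) / 2 + 5/72 * (1 + 2 * b - b\<^sup>2)"
    using that by simp
  have "- right_riemann (f_fam b) (Suc n) \<le> - right_riemann (f_fam b) n"
    if "b \<le> 1" "9/20 * m \<le> (1 - b) / 2 + 5/72 * (1 + 2 * b - b\<^sup>2)"
  proof (rule step[where I = "- I" and ?e1.0 = 1 and ?e2.0 = "-1"])
    show "\<bar>- right_riemann (f_fam b) n - (- I + 1 * d / real n - -1 * c / real n ^ 2)\<bar> \<le> M / real n ^ 4"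
      if "n \<ge> 1" for n by (rule negate[OF R[OF that]]) simp
    show "5/72 * (-1 * (1 + 2 * b - b\<^sup>2)) + 9/20 * m \<le> 1 * (1 - b) / 2"
      using that by (simp add: field_simps)
  qed (use that in simp_all)
  then show "right_riemann (f_fam b) n \<le> right_riemann (f_fam b) (Suc n)"
    if "b \<le> 1" "9/20 * m \<le> (1 - b) / 2 + 5/72 * (1 + 2 * b - b\<^sup>2)"
    using that by simp
qed

section \<open>The ranges of the parameter\<close>

text \<open>The two bounds below supply \<open>m\<close> in \<open>f_fam_monotone_steps\<close>. The first one takes the value of
  \<open>1 - b\<^sup>2 / 4\<close> at \<open>\<bar>b\<bar> = 1\<close>. The second one rests on
  \<open>1 - b\<^sup>2 / 4 = (2 - b) * (2 + b) / 4\<close>, by which one factor \<open>2 - b\<close> cancels; it is useful on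
  short intervals of positive \<open>b\<close>.\<close>

lemma remainder_bound_near_zero:
  fixes b :: real
  assumes "\<bar>b\<bar> \<le> 1"
  shows "1 / (30 * (1 - b\<^sup>2 / 4) ^ 3) * (2 - b) \<le> 32/405 * (2 - b)"
proof (rule mult_right_mono)
  have "b\<^sup>2 \<le> 1" using assms by (simp add: abs_square_le_1)
  then have "(3/4) ^ 3 \<le> (1 - b\<^sup>2 / 4) ^ 3" by (intro power_mono) auto
  then have "1 / (30 * (1 - b\<^sup>2 / 4) ^ 3) \<le> 1 / (30 * (3/4) ^ 3)"
    by (intro divide_left_mono mult_pos_pos) (use \<open>b\<^sup>2 \<le> 1\<close> in simp_all)
  then show "1 / (30 * (1 - b\<^sup>2 / 4) ^ 3) \<le> 32/405" by (simp add: power_divide)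
qed (use assms in auto)

lemma remainder_bound_interval:
  fixes b l r :: real
  assumes b: "l \<le> b" "b \<le> r" and lr: "-2 < l" "r < 2"
  shows "1 / (30 * (1 - b\<^sup>2 / 4) ^ 3) * (2 - b) \<le> 32 / (15 * ((2 - r)\<^sup>2 * (2 + l) ^ 3))"
proof -
  have pos: "2 - b > 0" "2 + b > 0" using assms by auto
  have factor: "1 - b\<^sup>2 / 4 = (2 - b) * (2 + b) / 4" by (simp add: power2_eq_square algebra_simps)
  have "1 / (30 * (1 - b\<^sup>2 / 4) ^ 3) * (2 - b) = 32 / (15 * ((2 - b)\<^sup>2 * (2 + b) ^ 3))"
    unfolding factor using pos by (simp add: power_mult_distrib power_divide divide_simps) (simp add: power3_eq_cube power2_eq_square)
  also have "\<dots> \<le> 32 / (15 * ((2 - r)\<^sup>2 * (2 + l) ^ 3))"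
    using assms pos by (intro divide_left_mono mult_left_mono mult_mono power_mono mult_pos_pos) auto
  finally show ?thesis .
qed

lemma f_fam_convex_decreasing:
  assumes b: "b \<le> -1"
  shows "convex_on {0..1} (f_fam b)" and "x \<in> {0..1} \<Longrightarrow> f_fam b 1 \<le> f_fam b x"
proof -
  have g: "1 - b * x + x\<^sup>2 > 0" if "x \<in> {0..1}" for x
    using mult_nonneg_nonneg[of "- b" x] that b by (simp add: add_pos_nonneg)
  show "convex_on {0..1} (f_fam b)"
  proof (rule f''_ge0_imp_convex)
    fix x :: real assume x: "x \<in> {0..1}"
    have "b\<^sup>2 \<ge> 1" using power_mono[of 1 "- b" 2] b by simp
    moreover have "0 \<le> - b * x" using mult_nonneg_nonneg[of "- b" x] x b by simp
    moreover have "0 \<le> x\<^sup>2" by simp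
    ultimately have "6 * x\<^sup>2 - 6 * b * x + 2 * b\<^sup>2 - 2 \<ge> 0" unfolding mult.assoc by linarith
    then show "f_fam2 b x \<ge> 0" using g[OF x] by (simp add: f_fam2_def)
    show "(f_fam b has_real_derivative f_fam1 b x) (at x)"
      "(f_fam1 b has_real_derivative f_fam2 b x) (at x)"
      using f_fam_derivs[of b x] g[OF x] by auto
  qed simp
  assume x: "x \<in> {0..1}"
  have "x\<^sup>2 \<le> 1" using x by (simp add: abs_square_le_1)
  moreover have "- b * x \<le> - b" using mult_left_mono[of x 1 "- b"] x b by simp
  ultimately have "1 - b * x + x\<^sup>2 \<le> 1 - b * 1 + 1\<^sup>2" by simp
  then show "f_fam b 1 \<le> f_fam b x"
    unfolding f_fam_def using g[OF x] g[of 1] by (intro divide_left_mono) auto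
qed

lemma f_fam_first_step:
  assumes b: "b < 2"
  shows "b \<le> 1/2 \<Longrightarrow> left_riemann (f_fam b) 2 \<le> left_riemann (f_fam b) 1"
    and "1/2 \<le> b \<Longrightarrow> left_riemann (f_fam b) 1 \<le> left_riemann (f_fam b) 2"
    and "b \<le> 3/2 \<Longrightarrow> right_riemann (f_fam b) 1 \<le> right_riemann (f_fam b) 2"
    and "3/2 \<le> b \<Longrightarrow> right_riemann (f_fam b) 2 \<le> right_riemann (f_fam b) 1"
proof -
  have half: "f_fam b (1/2) = 4 / (5 - 2 * b)"
    using b by (simp add: f_fam_def field_simps power2_eq_square)
  have one: "left_riemann (f_fam b) 1 = 1" "right_riemann (f_fam b) 1 = 1 / (2 - b)"
    by (simp_all add: left_riemann_def right_riemann_def f_fam_def)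
  have two: "left_riemann (f_fam b) 2 = (1 + 4 / (5 - 2 * b)) / 2"
    "right_riemann (f_fam b) 2 = (4 / (5 - 2 * b) + 1 / (2 - b)) / 2"
    unfolding half[symmetric] by (simp_all add: left_riemann_def right_riemann_def numeral_2_eq_2)
      (simp_all add: f_fam_def)
  show "b \<le> 1/2 \<Longrightarrow> left_riemann (f_fam b) 2 \<le> left_riemann (f_fam b) 1"
    "1/2 \<le> b \<Longrightarrow> left_riemann (f_fam b) 1 \<le> left_riemann (f_fam b) 2"
    unfolding one two using b by (simp_all add: divide_simps)
  have "1 / (2 - b) \<le> 4 / (5 - 2 * b) \<longleftrightarrow> b \<le> 3/2" "4 / (5 - 2 * b) \<le> 1 / (2 - b) \<longleftrightarrow> 3/2 \<le> b"
    using b by (auto simp: divide_simps)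
  then show "b \<le> 3/2 \<Longrightarrow> right_riemann (f_fam b) 1 \<le> right_riemann (f_fam b) 2"
    "3/2 \<le> b \<Longrightarrow> right_riemann (f_fam b) 2 \<le> right_riemann (f_fam b) 1"
    unfolding one two by simp_all
qed

text \<open>This keeps \<open>b\<close> away from \<open>2\<close>, where the peak of \<open>f_fam b\<close> and hence the remainder become
  unbounded.\<close>

lemma beta_plus_less: "beta_plus < 1652/1000"
proof -
  have "sqrt 13 < 3608/1000" by (rule real_less_lsqrt) (simp_all add: power2_eq_square)
  then show ?thesis by (simp add: beta_plus_def)
qed

lemma left_riemann_f_fam_decreasing:
  assumes b: "b \<le> 1/2" and n: "n \<ge> 1"
  shows "left_riemann (f_fam b) (Suc n) \<le> left_riemann (f_fam b) n"
proof -
  consider "b \<le> -1" | "n = 1" | "b > -1" "n \<ge> 2" using n by linarith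
  then show ?thesis
  proof cases
    case 1
    then show ?thesis
      using left_riemann_Suc_le_of_convex[OF f_fam_convex_decreasing n] by blast
  next
    case 2
    then show ?thesis using f_fam_first_step(1)[of b] b by (simp add: numeral_2_eq_2)
  next
    case 3
    have "5/72 * (1 + 2 * b - q) + 9/20 * (32/405 * (2 - b)) \<le> (1 - b) / 2" if "q \<ge> 0" for q
      using b that by (simp add: field_simps)
    from this[of "b\<^sup>2"] 3 b show ?thesis
      by (intro f_fam_monotone_steps(1)[OF _ remainder_bound_near_zero]) auto
  qed
qed

lemma right_riemann_f_fam_increasing:
  assumes b: "b \<le> 1" and n: "n \<ge> 1"
  shows "right_riemann (f_fam b) n \<le> right_riemann (f_fam b) (Suc n)"
proof -
  consider "b \<le> -1" | "n = 1" | "b > -1" "n \<ge> 2" using n by linarith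
  then show ?thesis
  proof cases
    case 1
    then show ?thesis
      using right_riemann_le_Suc_of_convex[OF f_fam_convex_decreasing n] by blast
  next
    case 2
    then show ?thesis using f_fam_first_step(3)[of b] b by (simp add: numeral_2_eq_2)
  next
    case 3
    have "b\<^sup>2 \<le> 1" using b 3 by (simp add: abs_square_le_1)
    then have "9/20 * (32/405 * (2 - b)) \<le> (1 - b) / 2 + 5/72 * (1 + 2 * b - b\<^sup>2)"
      using b by (simp add: field_simps)
    with 3 b show ?thesis
      by (intro f_fam_monotone_steps(3)[OF _ remainder_bound_near_zero]) auto
  qed
qed

text \<open>The condition of \<open>f_fam_monotone_steps\<close> is concave in \<open>b\<close>, so that \<open>b\<^sup>2\<close> may be replaced by its
  chord on an interval. One interval is not enough, since \<open>remainder_bound_interval\<close> then loses too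
  much; splitting at \<open>13/10\<close> leaves room on both parts.\<close>

lemma left_riemann_f_fam_increasing:
  assumes b: "1 \<le> b" "b \<le> beta_plus" and n: "n \<ge> 1"
  shows "left_riemann (f_fam b) n \<le> left_riemann (f_fam b) (Suc n)"
proof -
  have b': "b < 1652/1000" using b beta_plus_less by linarith
  have chord: "b\<^sup>2 \<le> (l + r) * b - l * r" if "l \<le> b" "b \<le> r" for l r
    using mult_nonneg_nonneg[of "b - l" "r - b"] that by (simp add: power2_eq_square algebra_simps)
  consider "n = 1" | "n \<ge> 2" "b \<le> 13/10" | "n \<ge> 2" "13/10 \<le> b" using n by linarith
  then show ?thesis
  proof cases
    case 1
    then show ?thesis using f_fam_first_step(2)[of b] b b' by (simp add: numeral_2_eq_2)
  next
    case 2
    show ?thesis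
      by (rule f_fam_monotone_steps(2)[OF _ remainder_bound_interval[of 1 _ "13/10"]])
        (use 2 b chord[of 1 "13/10"] in \<open>auto simp: power_divide field_simps\<close>)
  next
    case 3
    show ?thesis
      by (rule f_fam_monotone_steps(2)[OF _ remainder_bound_interval[of "13/10" _ "1652/1000"]])
        (use 3 b b' chord[of "13/10" "1652/1000"] in \<open>auto simp: power_divide field_simps\<close>)
  qed
qed

text \<open>Here \<open>b\<^sup>2\<close> occurs with the opposite sign, and the tangent of \<open>b\<^sup>2\<close> at \<open>3/2\<close> makes the condition
  linear. Two intervals are again needed; with the cut at \<open>158/100\<close> both inequalities hold with a
  margin of about one hundredth of their size.\<close>

lemma right_riemann_f_fam_decreasing:
  assumes b: "3/2 \<le> b" "b \<le> beta_plus" and n: "n \<ge> 1"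
  shows "right_riemann (f_fam b) (Suc n) \<le> right_riemann (f_fam b) n"
proof -
  have b': "b < 1652/1000" using b beta_plus_less by linarith
  have "0 \<le> (b - 3/2)\<^sup>2" by simp
  then have tangent: "b\<^sup>2 \<ge> 3 * b - 9/4" by (simp add: power2_eq_square algebra_simps)
  consider "n = 1" | "n \<ge> 2" "b \<le> 158/100" | "n \<ge> 2" "158/100 \<le> b" using n by linarith
  then show ?thesis
  proof cases
    case 1
    then show ?thesis using f_fam_first_step(4)[of b] b b' by (simp add: numeral_2_eq_2)
  next
    case 2
    show ?thesis
      by (rule f_fam_monotone_steps(4)[OF _ remainder_bound_interval[of "3/2" _ "158/100"]])
        (use 2 b tangent in \<open>auto simp: power_divide field_simps\<close>)
  next
    case 3
    show ?thesis
      by (rule f_fam_monotone_steps(4)[OF _ remainder_bound_interval[of "158/100" _ "1652/1000"]])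
        (use 3 b b' tangent in \<open>auto simp: power_divide field_simps\<close>)
  qed
qed

lemma mono_on_of_steps:
  fixes X :: "nat \<Rightarrow> real"
  assumes "\<And>n. n \<ge> 1 \<Longrightarrow> X n \<le> X (Suc n)"
  shows "mono_on {1..} X"
  by (rule mono_onI) (rule lift_Suc_mono_le_ivl[where N = "{1..}"], use assms in auto)

lemma antimono_on_of_steps:
  fixes X :: "nat \<Rightarrow> real"
  assumes "\<And>n. n \<ge> 1 \<Longrightarrow> X (Suc n) \<le> X n"
  shows "antimono_on {1..} X"
  by (rule monotone_onI) (rule lift_Suc_antimono_le_ivl[where N = "{1..}"], use assms in auto)

theorem theorem3p1:
  shows "(\<forall>b::real. b \<le> 1/2 \<longrightarrow> antimono_on {1..} (\<lambda>n. left_riemann (f_fam b) n))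
       \<and> (\<forall>b::real. 1 \<le> b \<and> b \<le> beta_plus \<longrightarrow> mono_on {1..} (\<lambda>n. left_riemann (f_fam b) n))
       \<and> (\<forall>b::real. b \<le> 1 \<longrightarrow> mono_on {1..} (\<lambda>n. right_riemann (f_fam b) n))
       \<and> (\<forall>b::real. 3/2 \<le> b \<and> b \<le> beta_plus \<longrightarrow> antimono_on {1..} (\<lambda>n. right_riemann (f_fam b) n))"
  by (intro conjI allI impI mono_on_of_steps antimono_on_of_steps; (elim conjE)?)
    (rule left_riemann_f_fam_decreasing left_riemann_f_fam_increasing
      right_riemann_f_fam_increasing right_riemann_f_fam_decreasing; assumption)+

end
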